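(* Algorithm \textsf{S} (defined below), run on an undirected graph with vertex set $[n]$, $n>1$, takes $O(\lg^2 n)$ steps.
   Context: Each edge $e$ has two ends $e.v,e.w$. Each vertex $v$ has a parent $v.p$, initially $v$; $v$ is a root if $v.p=v$. Vertices are compared as integers. Each operation is performed simultaneously for all edges/vertices using values at the start of the operation. \textsc{parent-connect}: for each edge $e$, let $x=e.v.p$, $y=e.w.p$; send $\min\{x,y\}$ to $\max\{x,y\}$. \textsc{root-update}: for each root $v$, replace $v.p$ by the minimum of $v.p$ and the vertices sent to $v$ in the preceding \textsc{parent-connect}. \textsc{shortcut}: for each vertex $v$, replace $v.p$ by $(v.p).p$. Algorithm \textsf{S}: repeat \{\textsc{parent-connect}; \textsc{root-update}; repeat \textsc{shortcut} until no parent changes\} until no parent changes. Each operation is implemented in a constant number of synchronous concurrent message-passing steps, so the number of steps is within a constant factor of the total number of operations executed. $\lg$ is the base-two logarithm. *)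

theory Defs
  imports Complex_Main "HOL-Library.Multiset"
begin

text \<open>
  An undirected graph on \<open>{1..n}\<close> is a finite multiset of edges; the pair \<open>e\<close> lists the two ends
  \<open>e.v = fst e\<close> and \<open>e.w = snd e\<close> in an arbitrary order. Loops and parallel edges are allowed.
\<close>
type_synonym edge = "nat \<times> nat"

definition graph_on :: "nat \<Rightarrow> edge multiset \<Rightarrow> bool" where
  "graph_on n E \<longleftrightarrow> (\<forall>e \<in># E. fst e \<in> {1..n} \<and> snd e \<in> {1..n})"

type_synonym parents = "nat \<Rightarrow> nat"

text \<open>Outside \<open>{1..n}\<close> a parent function is the identity throughout, so equality of two parent
  functions says that the parents of all vertices agree.\<close>

definition init_parents :: parents where
  "init_parents = (\<lambda>v. v)"

text \<open>A message \<open>(u, x)\<close> is the vertex \<open>u\<close> sent to the vertex \<open>x\<close>.\<close>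

definition parent_connect :: "edge multiset \<Rightarrow> parents \<Rightarrow> (nat \<times> nat) set" where
  "parent_connect E p =
     {(min x y, max x y) | x y. \<exists>e \<in># E. x = p (fst e) \<and> y = p (snd e)}"

definition root_update :: "nat \<Rightarrow> (nat \<times> nat) set \<Rightarrow> parents \<Rightarrow> parents" where
  "root_update n M p =
     (\<lambda>v. if v \<in> {1..n} \<and> p v = v then Min (insert (p v) {u. (u, v) \<in> M}) else p v)"

definition shortcut :: "nat \<Rightarrow> parents \<Rightarrow> parents" where
  "shortcut n p = (\<lambda>v. if v \<in> {1..n} then p (p v) else p v)"

datatype operation = Parent_Connect | Root_Update | Shortcut

text \<open>\<open>exec p ops p'\<close>: execution from parents \<open>p\<close> terminates with parents \<open>p'\<close>, having performed
  the sequence of operations \<open>ops\<close>.\<close>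

inductive repeat_until_stable ::
  "(parents \<Rightarrow> operation list \<Rightarrow> parents \<Rightarrow> bool) \<Rightarrow> parents \<Rightarrow> operation list \<Rightarrow> parents \<Rightarrow> bool"
  for exec where
  stable: "exec p ops p' \<Longrightarrow> p' = p \<Longrightarrow> repeat_until_stable exec p ops p'"
| again: "exec p ops p' \<Longrightarrow> p' \<noteq> p \<Longrightarrow> repeat_until_stable exec p' ops' p'' \<Longrightarrow>
    repeat_until_stable exec p (ops @ ops') p''"

definition exec_shortcut :: "nat \<Rightarrow> parents \<Rightarrow> operation list \<Rightarrow> parents \<Rightarrow> bool" where
  "exec_shortcut n p ops p' \<longleftrightarrow> ops = [Shortcut] \<and> p' = shortcut n p"

definition exec_round ::
  "nat \<Rightarrow> edge multiset \<Rightarrow> parents \<Rightarrow> operation list \<Rightarrow> parents \<Rightarrow> bool" where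
  "exec_round n E p ops p' \<longleftrightarrow>
     (\<exists>ops'. ops = [Parent_Connect, Root_Update] @ ops' \<and>
        repeat_until_stable (exec_shortcut n) (root_update n (parent_connect E p) p) ops' p')"

definition algorithm_S :: "nat \<Rightarrow> edge multiset \<Rightarrow> operation list \<Rightarrow> parents \<Rightarrow> bool" where
  "algorithm_S n E ops p' \<longleftrightarrow> repeat_until_stable (exec_round n E) init_parents ops p'"

text \<open>\<open>cost\<close> gives, for each kind of operation, the constant number of synchronous message-passing
  steps that implement it.\<close>

definition steps :: "(operation \<Rightarrow> nat) \<Rightarrow> operation list \<Rightarrow> nat" where
  "steps cost ops = (\<Sum>f\<leftarrow>ops. cost f)"

end

theory Submission
  imports Defs
begin

text \<open>
  Every round starts and ends with flat trees, so a round acts on the graph obtained by contracting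
  each tree to its root. Call a root active if it has a neighbour in this graph. Suppose that \<open>v\<close> is
  active and remains a root for two rounds. Then \<open>v\<close> is smaller than all its neighbours, and each
  neighbour \<open>w\<close> ends the first round in a tree whose root is at most \<open>v\<close>; were that root smaller
  than \<open>v\<close>, the vertex \<open>v\<close> would be linked in the second round. Hence \<open>w\<close> has been absorbed by \<open>v\<close>,
  and \<open>v \<mapsto> w\<close> injects the survivors into the non-survivors: two rounds at least halve the number of
  active roots. One round needs only logarithmically many shortcuts because each shortcut squares the
  parent function.
\<close>

section \<open>Descending parent functions and their iterates\<close>

text \<open>Being the identity outside \<open>{1..n}\<close> makes \<open>shortcut n p\<close> the
  full composition \<open>p \<circ> p\<close>, so repeated shortcuts become iteration of one
  function.\<close>

definition descending :: "nat \<Rightarrow> parents \<Rightarrow> bool" where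
  "descending n p \<longleftrightarrow>
     (\<forall>v. p v \<le> v) \<and> (\<forall>v \<in> {1..n}. p v \<in> {1..n}) \<and> (\<forall>v. v \<notin> {1..n} \<longrightarrow> p v = v)"

definition flat :: "parents \<Rightarrow> bool" where
  "flat p \<longleftrightarrow> (\<forall>v. p (p v) = p v)"

lemma descending_le: "descending n p \<Longrightarrow> p v \<le> v"
  by (simp add: descending_def)

lemma descending_in: "descending n p \<Longrightarrow> v \<in> {1..n} \<Longrightarrow> p v \<in> {1..n}"
  unfolding descending_def by blast

lemma descending_outside: "descending n p \<Longrightarrow> v \<notin> {1..n} \<Longrightarrow> p v = v"
  unfolding descending_def by blast

lemma descending_comp:
  assumes "descending n p" "descending n q"
  shows "descending n (p \<circ> q)"
  unfolding descending_def
proof (intro conjI allI ballI impI)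
  show "(p \<circ> q) v \<le> v" for v
    using descending_le[OF assms(1), of "q v"] descending_le[OF assms(2), of v] by simp
qed (use assms descending_in descending_outside in \<open>metis comp_apply\<close>)+

lemma descending_funpow: "descending n p \<Longrightarrow> descending n (p ^^ m)"
  by (induction m) (auto simp: descending_comp, simp add: descending_def)

lemma shortcut_eq_comp: "descending n p \<Longrightarrow> shortcut n p = p \<circ> p"
  by (auto simp: shortcut_def fun_eq_iff descending_outside)

text \<open>Every application of \<open>p\<close> that moves a vertex lowers it by at least one, and
  a vertex that stops moving stays put.\<close>

lemma funpow_descends:
  assumes "descending n p"
  shows "p ((p ^^ m) v) = (p ^^ m) v \<or> (p ^^ m) v + m \<le> v"
proof (induction m)
  case (Suc m)
  then show ?case
    using descending_le[OF assms, of "(p ^^ m) v"] by (cases "p ((p ^^ m) v) = (p ^^ m) v") auto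
qed simp

lemma funpow_stable:
  assumes "descending n p" "n \<le> m"
  shows "p ((p ^^ m) v) = (p ^^ m) v"
proof (cases "v \<in> {1..n}")
  case True
  then have "(p ^^ m) v \<in> {1..n}"
    using descending_funpow[OF assms(1)] descending_in by blast
  \<comment> \<open>Still moving after \<open>m \<ge> n\<close> applications would mean a drop of at
    least \<open>n\<close>, leaving \<open>{1..n}\<close>.\<close>
  then show ?thesis
    using funpow_descends[OF assms(1), of m v] True assms(2) by auto
next
  case False
  then have "(p ^^ m) v = v"
    using descending_funpow[OF assms(1)] descending_outside by blast
  then show ?thesis
    using False assms(1) descending_outside by simp
qed

lemma funpow_fixed_imp_fixed:
  assumes "descending n p" "(p ^^ m) v = v" "m > 0"
  shows "p v = v"
  using funpow_descends[OF assms(1), of m v] assms(2,3) by auto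

section \<open>Repeated shortcutting\<close>

lemma funpow_comp_self: "(p \<circ> p) ^^ m = p ^^ (2 * m)"
proof -
  have "p \<circ> p = p ^^ 2"
    by (simp add: numeral_2_eq_2)
  then show ?thesis
    by (simp only: funpow_mult)
qed

text \<open>A shortcut replaces \<open>q\<close> by its square, which needs half as many
  applications to reach the roots, so the induction lowers \<open>j\<close> by one. At
  \<open>j = 0\<close> the function is idempotent and the loop stops.\<close>

lemma repeat_shortcut_exists:
  assumes "descending n q" "\<And>v. q ((q ^^ 2 ^ j) v) = (q ^^ 2 ^ j) v"
  shows "\<exists>ops p'. repeat_until_stable (exec_shortcut n) q ops p'"
  using assms
proof (induction j arbitrary: q)
  case 0
  then have "shortcut n q = q"
    by (simp add: shortcut_eq_comp fun_eq_iff)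
  then show ?case
    by (blast intro: stable exec_shortcut_def[THEN iffD2])
next
  case (Suc j)
  let ?q = "shortcut n q"
  have eq: "?q = q \<circ> q"
    using Suc.prems(1) by (rule shortcut_eq_comp)
  have "descending n ?q"
    using Suc.prems(1) by (simp add: eq descending_comp)
  moreover have "?q ((?q ^^ 2 ^ j) v) = (?q ^^ 2 ^ j) v" for v
    using Suc.prems(2) by (simp add: eq funpow_comp_self)
  ultimately obtain ops p' where "repeat_until_stable (exec_shortcut n) ?q ops p'"
    using Suc.IH by blast
  then show ?case
    by (cases "?q = q")
      (blast intro: stable again exec_shortcut_def[THEN iffD2])+
qed

text \<open>At most \<open>j\<close> squarings change anything; the additional operation is the
  shortcut that detects stability.\<close>

lemma repeat_shortcut_length:
  assumes "descending n q" "\<And>v. q ((q ^^ 2 ^ j) v) = (q ^^ 2 ^ j) v"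
    and "repeat_until_stable (exec_shortcut n) q ops p'"
  shows "length ops \<le> j + 1"
  using assms
proof (induction j arbitrary: q ops)
  case 0
  then have "shortcut n q = q"
    by (simp add: shortcut_eq_comp fun_eq_iff)
  with 0(3) show ?case
    by (auto simp: exec_shortcut_def elim: repeat_until_stable.cases)
next
  case (Suc j)
  let ?q = "shortcut n q"
  have eq: "?q = q \<circ> q"
    using Suc.prems(1) by (rule shortcut_eq_comp)
  have desc: "descending n ?q"
    using Suc.prems(1) by (simp add: eq descending_comp)
  have stab: "?q ((?q ^^ 2 ^ j) v) = (?q ^^ 2 ^ j) v" for v
    using Suc.prems(2) by (simp add: eq funpow_comp_self)
  from Suc.prems(3) show ?case
  proof cases
    case stable
    then show ?thesis by (simp add: exec_shortcut_def)
  next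
    case (again ops1 p1 ops2)
    then have "length ops2 \<le> j + 1"
      using Suc.IH[OF desc stab] unfolding exec_shortcut_def[of n q] by blast
    with again show ?thesis by (simp add: exec_shortcut_def)
  qed
qed

text \<open>The stopping test \<open>q \<circ> q = q\<close> is flatness, and squarings compose to a
  positive iterate of the original function.\<close>

lemma repeat_shortcut_result:
  assumes "repeat_until_stable (exec_shortcut n) q ops p'" "descending n q"
  shows "flat p' \<and> (\<exists>m>0. p' = q ^^ m)"
  using assms
proof (induction rule: repeat_until_stable.induct)
  case (stable q ops p')
  then have "q \<circ> q = q"
    using shortcut_eq_comp by (metis exec_shortcut_def)
  moreover have "q = q ^^ 1"
    by simp
  ultimately show ?case
    using stable by (metis comp_apply flat_def zero_less_one)
next
  case (again q ops q' ops' p')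
  then have q': "q' = q \<circ> q"
    by (simp add: exec_shortcut_def shortcut_eq_comp)
  then obtain m where "flat p'" "m > 0" "p' = q' ^^ m"
    using again descending_comp by blast
  then show ?case
    by (metis q' funpow_comp_self nat_0_less_mult_iff zero_less_numeral)
qed

section \<open>The contracted graph and the effect of connecting\<close>

text \<open>Adjacency after contracting each flat tree to its root. Unordered pairs absorb the
  arbitrary orientation of edges; an edge inside a tree becomes a loop, hence the condition
  \<open>w \<noteq> v\<close> in \<open>active_roots\<close>.\<close>

definition linked :: "edge multiset \<Rightarrow> parents \<Rightarrow> nat \<Rightarrow> nat \<Rightarrow> bool" where
  "linked E p x y \<longleftrightarrow> (\<exists>e \<in># E. {x, y} = {p (fst e), p (snd e)})"

definition active_roots :: "nat \<Rightarrow> edge multiset \<Rightarrow> parents \<Rightarrow> nat set" where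
  "active_roots n E p = {v \<in> {1..n}. p v = v \<and> (\<exists>w. linked E p v w \<and> w \<noteq> v)}"

lemma finite_active_roots [simp]: "finite (active_roots n E p)"
  by (simp add: active_roots_def)

lemma linked_sym: "linked E p x y \<longleftrightarrow> linked E p y x"
  by (simp add: linked_def insert_commute)

lemma linked_roots:
  assumes "linked E p x y" "graph_on n E" "descending n p" "flat p"
  shows "x \<in> {1..n}" "y \<in> {1..n}" "p x = x" "p y = y"
proof -
  obtain e where "e \<in># E" and e: "{x, y} = {p (fst e), p (snd e)}"
    using assms(1) unfolding linked_def by blast
  then have "fst e \<in> {1..n}" "snd e \<in> {1..n}"
    using assms(2) unfolding graph_on_def by blast+
  then have "p (fst e) \<in> {1..n}" "p (snd e) \<in> {1..n}"
    using assms(3) descending_in by blast+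
  then have "\<forall>z \<in> {p (fst e), p (snd e)}. z \<in> {1..n} \<and> p z = z"
    using assms(4) unfolding flat_def by blast
  then show "x \<in> {1..n}" "y \<in> {1..n}" "p x = x" "p y = y"
    unfolding e[symmetric] by auto
qed

lemma in_parent_connect_iff: "(u, v) \<in> parent_connect E p \<longleftrightarrow> linked E p v u \<and> u \<le> v"
proof -
  have "(u, v) = (min x y, max x y) \<longleftrightarrow> {v, u} = {x, y} \<and> u \<le> v" for x y
    by (auto simp: doubleton_eq_iff min_def max_def)
  then show ?thesis
    unfolding parent_connect_def linked_def by blast
qed

text \<open>\<open>Min\<close> behaves as a minimum only on finite sets; messages to
  \<open>v\<close> never exceed \<open>v\<close>.\<close>

lemma finite_messages: "finite {u. (u, v) \<in> parent_connect E p}"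
  by (rule finite_subset[of _ "{..v}"]) (auto simp: in_parent_connect_iff)

lemma root_update_nonroot: "p v \<noteq> v \<Longrightarrow> root_update n M p v = p v"
  by (simp add: root_update_def)

lemma root_update_root_cases:
  assumes "v \<in> {1..n}" "p v = v"
  shows "root_update n (parent_connect E p) p v = v \<or>
    linked E p v (root_update n (parent_connect E p) p v)"
proof -
  have "root_update n (parent_connect E p) p v \<in> insert (p v) {u. (u, v) \<in> parent_connect E p}"
    using assms Min_in[of "insert (p v) {u. (u, v) \<in> parent_connect E p}"] finite_messages
    by (simp add: root_update_def)
  then show ?thesis
    using assms(2) by (auto simp: in_parent_connect_iff)
qed

lemma root_update_le_neighbour:
  assumes "v \<in> {1..n}" "p v = v" "linked E p v u" "u \<le> v"
  shows "root_update n (parent_connect E p) p v \<le> u"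
  using assms finite_messages[of v E p]
  by (simp add: root_update_def in_parent_connect_iff)

lemma descending_root_update:
  assumes "graph_on n E" "descending n p" "flat p"
  shows "descending n (root_update n (parent_connect E p) p)"
    (is "descending n ?q")
  unfolding descending_def
proof (intro conjI allI ballI impI)
  show "?q v \<le> v" for v
    using assms(2) finite_messages[of v E p]
    by (auto simp: root_update_def descending_le intro: Min_le)
  show "?q v \<in> {1..n}" if "v \<in> {1..n}" for v
  proof (cases "p v = v")
    case True
    then show ?thesis
      using root_update_root_cases[where p = p, OF that True, of E] linked_roots(2)[OF _ assms] that
      by fastforce
  next
    case False
    then show ?thesis
      using descending_in[OF assms(2) that] by (simp add: root_update_nonroot)
  qed
  show "?q v = v" if "v \<notin> {1..n}" for v
    using that assms(2) unfolding root_update_def by (simp only: descending_outside if_False simp_thms)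
qed

section \<open>A single round\<close>

text \<open>Describes a round by its effect: \<open>q\<close> is the forest just after
  \<open>root_update\<close>, and the shortcut loop contributes only that \<open>p'\<close> is a
  flat positive iterate of \<open>q\<close>.\<close>

locale round_S =
  fixes n :: nat and E :: "edge multiset" and p q p' :: parents and m :: nat
  assumes graph: "graph_on n E" and desc: "descending n p" and flat: "flat p"
    and q_def: "q = root_update n (parent_connect E p) p"
    and m_pos: "m > 0" and p'_def: "p' = q ^^ m" and flat': "flat p'"
begin

lemma desc_q: "descending n q"
  unfolding q_def using graph desc flat by (rule descending_root_update)

lemma desc': "descending n p'"
  unfolding p'_def using desc_q by (rule descending_funpow)

text \<open>\<open>p' v\<close> is fixed by the positive iterate \<open>q ^^ m\<close>, and strict
  descent rules out cycles other than fixed points.\<close>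

lemma q_fixes_new_root: "q (p' v) = p' v"
  using funpow_fixed_imp_fixed[OF desc_q _ m_pos] flat' by (simp add: p'_def flat_def)

lemma new_parent_of_q: "p' (q v) = p' v"
  using q_fixes_new_root by (simp add: p'_def funpow_swap1)

text \<open>A non-root keeps its parent under \<open>root_update\<close>, so \<open>q\<close> moves
  it, whereas every root of \<open>p'\<close> is fixed by \<open>q\<close>.\<close>

lemma new_root_is_old_root:
  assumes "p' v = v"
  shows "p v = v"
  using q_fixes_new_root[of v] assms root_update_nonroot[of p v] by (metis q_def)

text \<open>Trees merge but never split: a non-root has \<open>q v = p v\<close>, and following
  \<open>q\<close> does not change the final root. The new contracted graph is thus a quotient of
  the old one.\<close>

lemma new_parent_of_old_parent: "p' (p v) = p' v"
  using new_parent_of_q[of v] root_update_nonroot[of p v] by (metis q_def)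

lemma new_parent_le_q: "p' v \<le> q v"
  using descending_le[OF desc', of "q v"] by (simp add: new_parent_of_q)

text \<open>\<open>root_update\<close> takes the smallest candidate, and shortcuts never raise a
  parent.\<close>

lemma new_parent_le_neighbour:
  assumes "linked E p v u" "u \<le> v"
  shows "p' v \<le> u"
proof -
  have "q v \<le> u"
    unfolding q_def
    by (rule root_update_le_neighbour) (use assms linked_roots[OF assms(1) graph desc flat] in auto)
  then show ?thesis
    using new_parent_le_q[of v] by simp
qed

lemma linked_new_parents:
  assumes "linked E p x y"
  shows "linked E p' (p' x) (p' y)"
proof -
  obtain e where e: "e \<in># E" "{x, y} = {p (fst e), p (snd e)}"
    using assms unfolding linked_def by blast
  have "{p' x, p' y} = p' ` {x, y}"
    by simp
  also have "\<dots> = {p' (fst e), p' (snd e)}"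
    by (simp add: e(2) new_parent_of_old_parent)
  finally show ?thesis
    using e(1) unfolding linked_def by blast
qed

lemma linked_new_parentsE:
  assumes "linked E p' x' y'"
  obtains x y where "linked E p x y" "x' = p' x" "y' = p' y"
proof -
  obtain e where e: "e \<in># E" "{x', y'} = {p' (fst e), p' (snd e)}"
    using assms unfolding linked_def by blast
  then have "linked E p (p (fst e)) (p (snd e))" "linked E p (p (snd e)) (p (fst e))"
    unfolding linked_def by blast+
  then show thesis
    using that e(2) new_parent_of_old_parent by (metis doubleton_eq_iff)
qed

text \<open>A root that moves under \<open>q\<close> moves to a neighbour, and an inactive
  \<open>v\<close> is a neighbour of no other root; so the path of \<open>w\<close> under
  \<open>q\<close> runs through old roots and avoids \<open>v\<close>.\<close>

lemma inactive_not_new_parent: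
  assumes v: "v \<in> {1..n}" "p v = v" "v \<notin> active_roots n E p"
    and w: "w \<in> {1..n}" "p w = w" "w \<noteq> v"
  shows "p' w \<noteq> v"
proof -
  have step: "q u \<in> {1..n} \<and> p (q u) = q u \<and> q u \<noteq> v"
    if u: "u \<in> {1..n}" "p u = u" "u \<noteq> v" for u
  proof (cases "q u = u")
    case False
    then have link: "linked E p u (q u)"
      using root_update_root_cases[where p = p, OF u(1,2)] by (auto simp: q_def)
    then have "q u \<noteq> v"
      using v u(3) linked_sym unfolding active_roots_def by blast
    then show ?thesis
      using linked_roots[OF link graph desc flat] by blast
  qed (use u in simp)
  have "(q ^^ i) w \<in> {1..n} \<and> p ((q ^^ i) w) = (q ^^ i) w \<and> (q ^^ i) w \<noteq> v" for i
    by (induction i) (use w step in auto)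
  then show ?thesis
    by (simp add: p'_def)
qed

lemma active_roots_antimono: "active_roots n E p' \<subseteq> active_roots n E p"
proof
  fix v assume "v \<in> active_roots n E p'"
  then obtain w where v: "v \<in> {1..n}" "p' v = v" and link: "linked E p' v w" "w \<noteq> v"
    unfolding active_roots_def by blast
  from link(1) obtain x y where xy: "linked E p x y" "v = p' x" "w = p' y"
    by (rule linked_new_parentsE)
  show "v \<in> active_roots n E p"
  proof (rule ccontr)
    assume inactive: "v \<notin> active_roots n E p"
    \<comment> \<open>No other old root ends at the inactive \<open>v\<close>, so the old link
      behind the new one starts at \<open>v\<close> itself and would make \<open>v\<close>
      active.\<close>
    have "x = v"
      using inactive_not_new_parent[OF v(1) new_root_is_old_root[OF v(2)] inactive]
        linked_roots[OF xy(1) graph desc flat] xy(2) by blast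
    moreover have "y \<noteq> v"
      using xy(3) link(2) v(2) by blast
    ultimately show False
      using inactive v xy(1) new_root_is_old_root unfolding active_roots_def by blast
  qed
qed

text \<open>No root receives a vertex other than itself, so nothing is linked, and iterates of a
  flat function are equal to it. This makes the outer loop stop.\<close>

lemma no_active_roots_imp_unchanged:
  assumes "active_roots n E p = {}"
  shows "q = p" "p' = p"
proof -
  show "q = p"
  proof
    fix v
    show "q v = p v"
    proof (cases "p v = v \<and> v \<in> {1..n}")
      case True
      then show ?thesis
        using assms root_update_root_cases[where p = p and v = v and n = n and E = E]
        unfolding q_def active_roots_def by force
    qed (auto simp: q_def root_update_def)
  qed
  moreover have "p ^^ Suc i = p" for i
    using flat by (induction i) (auto simp: flat_def)
  ultimately show "p' = p"
    using m_pos unfolding p'_def by (metis gr0_implies_Suc)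
qed

end

section \<open>Halving the active roots in two rounds\<close>

lemma two_rounds_halve_active_roots:
  assumes "round_S n E p q p' m" "round_S n E p' q' p'' m'"
  shows "2 * card (active_roots n E p'') \<le> card (active_roots n E p)"
proof -
  interpret A: round_S n E p q p' m by fact
  interpret B: round_S n E p' q' p'' m' by fact
  let ?A = "active_roots n E p" and ?S = "active_roots n E p''"
  have sub: "?S \<subseteq> ?A"
    using A.active_roots_antimono B.active_roots_antimono by blast
  have "\<exists>w \<in> ?A - ?S. p' w = v" if v_S: "v \<in> ?S" for v
  proof -
    have v: "p'' v = v" "p' v = v"
      using v_S B.new_root_is_old_root unfolding active_roots_def by blast+
    obtain w where w: "linked E p v w" "w \<noteq> v"
      using subsetD[OF sub v_S] unfolding active_roots_def by blast
    \<comment> \<open>A smaller neighbour would have captured \<open>v\<close> in the first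
      round.\<close>
    have "v < w"
      using A.new_parent_le_neighbour[OF w(1)] v(2) w(2) by linarith
    then have "p' w \<le> v"
      using A.new_parent_le_neighbour w(1) linked_sym by (metis less_imp_le)
    \<comment> \<open>After the first round \<open>v\<close> is linked to \<open>p' w\<close>; were
      that smaller, \<open>v\<close> would lose its root status in the second.\<close>
    moreover have "v \<le> p' w"
      using B.new_parent_le_neighbour[of v "p' w"] A.linked_new_parents[OF w(1)] v by force
    ultimately have "p' w = v"
      by simp
    moreover have "w \<in> ?A"
      using w linked_sym linked_roots[OF w(1) A.graph A.desc A.flat]
      unfolding active_roots_def by blast
    \<comment> \<open>A survivor would still be a root of \<open>p'\<close>, but
      \<open>p' w = v \<noteq> w\<close>.\<close>
    moreover have "w \<notin> ?S"
      using B.new_root_is_old_root[of w] \<open>p' w = v\<close> w(2) by (auto simp: active_roots_def)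
    ultimately show ?thesis
      by blast
  qed
  \<comment> \<open>Covering the survivors by the image of \<open>p'\<close> gives the cardinality
    bound without choosing a \<open>w\<close> for each \<open>v\<close>.\<close>
  then have "?S \<subseteq> p' ` (?A - ?S)"
    by blast
  then have "card ?S \<le> card (?A - ?S)"
    by (simp add: surj_card_le)
  also have "\<dots> = card ?A - card ?S"
    using sub by (simp add: card_Diff_subset)
  finally show ?thesis
    using card_mono[OF _ sub] by simp
qed

section \<open>Termination and operation counts\<close>

lemma exec_round_exists:
  assumes "graph_on n E" "descending n p" "flat p"
  shows "\<exists>ops p'. exec_round n E p ops p'"
proof -
  note desc = descending_root_update[OF assms]
  have "\<exists>ops p'. repeat_until_stable (exec_shortcut n)
      (root_update n (parent_connect E p) p) ops p'"
    \<comment> \<open>For existence the crude exponent \<open>j = n\<close> suffices, since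
      \<open>n < 2 ^ n\<close>.\<close>
    using repeat_shortcut_exists[OF desc] funpow_stable[OF desc] less_exp less_imp_le by blast
  then show ?thesis
    unfolding exec_round_def by blast
qed

lemma exec_round_round_S:
  assumes "graph_on n E" "descending n p" "flat p" "exec_round n E p ops p'"
  obtains q m where "round_S n E p q p' m"
proof -
  obtain ops' where "repeat_until_stable (exec_shortcut n)
      (root_update n (parent_connect E p) p) ops' p'"
    using assms(4) unfolding exec_round_def by blast
  from repeat_shortcut_result[OF this descending_root_update[OF assms(1-3)]]
  show thesis
    using that assms by (auto simp: round_S_def)
qed

text \<open>Two operations for connecting and updating, then at most \<open>L + 1\<close>
  shortcuts.\<close>

lemma exec_round_length:
  assumes "graph_on n E" "descending n p" "flat p" "exec_round n E p ops p'" "n \<le> 2 ^ L"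
  shows "length ops \<le> L + 3"
proof -
  note desc = descending_root_update[OF assms(1-3)]
  obtain ops' where ops': "ops = [Parent_Connect, Root_Update] @ ops'"
    "repeat_until_stable (exec_shortcut n) (root_update n (parent_connect E p) p) ops' p'"
    using assms(4) unfolding exec_round_def by blast
  have "length ops' \<le> L + 1"
    using repeat_shortcut_length[OF desc _ ops'(2)] funpow_stable[OF desc assms(5)] by blast
  then show ?thesis
    using ops'(1) by simp
qed

text \<open>Two rounds lower \<open>k\<close> by one; at \<open>k = 0\<close> no active root is left
  and the next round is stable.\<close>

lemma repeat_round_exists:
  assumes "graph_on n E" "descending n p" "flat p" "card (active_roots n E p) < 2 ^ k"
  shows "\<exists>ops p'. repeat_until_stable (exec_round n E) p ops p'"
  using assms(2-)
proof (induction k arbitrary: p)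
  case 0
  obtain ops p' where ex: "exec_round n E p ops p'"
    using exec_round_exists[OF assms(1) 0(1,2)] by blast
  then obtain q m where "round_S n E p q p' m"
    using exec_round_round_S[OF assms(1) 0(1,2)] by blast
  then have "p' = p"
    using 0(3) by (auto dest: round_S.no_active_roots_imp_unchanged)
  then show ?case
    using ex by (blast intro: stable)
next
  case (Suc k)
  obtain ops p' where ex: "exec_round n E p ops p'"
    using exec_round_exists[OF assms(1) Suc.prems(1,2)] by blast
  then obtain q m where r: "round_S n E p q p' m"
    using exec_round_round_S[OF assms(1) Suc.prems(1,2)] by blast
  note p' = round_S.desc'[OF r] round_S.flat'[OF r]
  obtain ops' p'' where ex': "exec_round n E p' ops' p''"
    using exec_round_exists[OF assms(1) p'] by blast
  then obtain q' m' where r': "round_S n E p' q' p'' m'"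
    using exec_round_round_S[OF assms(1) p'] by blast
  have "card (active_roots n E p'') < 2 ^ k"
    using two_rounds_halve_active_roots[OF r r'] Suc.prems(3) by simp
  then obtain ops'' r where "repeat_until_stable (exec_round n E) p'' ops'' r"
    using Suc.IH round_S.desc'[OF r'] round_S.flat'[OF r'] by blast
  then show ?case
    using ex ex' by (metis stable again)
qed

text \<open>Two rounds for each halving and a last one that changes nothing, each of at most
  \<open>L + 3\<close> operations. The loop may also stop after either round of a pair.\<close>

lemma repeat_round_length:
  assumes "graph_on n E" "n \<le> 2 ^ L"
    and "descending n p" "flat p" "card (active_roots n E p) < 2 ^ k"
    and "repeat_until_stable (exec_round n E) p ops r"
  shows "length ops \<le> (2 * k + 1) * (L + 3)"
  using assms(3-)
proof (induction k arbitrary: p ops)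
  case 0
  note len = exec_round_length[OF assms(1) 0(1,2) _ assms(2)]
  have unchanged: "p' = p" if "exec_round n E p ops' p'" for ops' p'
    using exec_round_round_S[OF assms(1) 0(1,2) that] 0(3)
    by (auto dest: round_S.no_active_roots_imp_unchanged)
  from 0(4) show ?case
    by cases (use len unchanged in auto)
next
  case (Suc k)
  note len = exec_round_length[OF assms(1) Suc.prems(1,2) _ assms(2)]
  from Suc.prems(4) show ?case
  proof cases
    case stable
    then show ?thesis using len[of ops] by fastforce
  next
    case (again ops1 p' ops2)
    then obtain q m where r: "round_S n E p q p' m"
      using exec_round_round_S[OF assms(1) Suc.prems(1,2)] by blast
    note p' = round_S.desc'[OF r] round_S.flat'[OF r]
    note len' = exec_round_length[OF assms(1) p' _ assms(2)]
    from again(4) have "length ops2 \<le> (2 * k + 2) * (L + 3)"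
    proof cases
      case stable
      then show ?thesis using len'[of ops2] by fastforce
    next
      case (again ops3 p'' ops4)
      then obtain q' m' where r': "round_S n E p' q' p'' m'"
        using exec_round_round_S[OF assms(1) p'] by blast
      have "card (active_roots n E p'') < 2 ^ k"
        using two_rounds_halve_active_roots[OF r r'] Suc.prems(3) by simp
      then have "length ops4 \<le> (2 * k + 1) * (L + 3)"
        using Suc.IH round_S.desc'[OF r'] round_S.flat'[OF r'] again(4) by blast
      then show ?thesis
        using again len'[of ops3 p''] by simp
    qed
    then show ?thesis
      using again len[of ops1 p'] by simp
  qed
qed

section \<open>From operations to steps\<close>

lemma steps_le_length:
  "steps cost ops \<le> (cost Parent_Connect + cost Root_Update + cost Shortcut) * length ops"
proof (induction ops)
  case (Cons f ops)
  then show ?case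
    by (cases f) (auto simp: steps_def)
qed (simp add: steps_def)

text \<open>Executions form a relation, so termination is asserted separately to keep the bound from
  holding vacuously. The constant depends on \<open>cost\<close> alone.\<close>

theorem theorem5:
  fixes cost :: "operation \<Rightarrow> nat"
  shows "\<exists>C::real. \<forall>n>1. \<forall>E. graph_on n E \<longrightarrow>
           (\<exists>ops p. algorithm_S n E ops p) \<and>
           (\<forall>ops p. algorithm_S n E ops p \<longrightarrow>
              real (steps cost ops) \<le> C * (log 2 (real n))\<^sup>2)"
proof -
  define K where "K = cost Parent_Connect + cost Root_Update + cost Shortcut"
  have "(\<exists>ops p. algorithm_S n E ops p) \<and>
      (\<forall>ops p. algorithm_S n E ops p \<longrightarrow>
        real (steps cost ops) \<le> real (25 * K) * (log 2 (real n))\<^sup>2)"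
    if n: "n > 1" and graph: "graph_on n E" for n E
  proof -
    \<comment> \<open>\<open>k\<close> is the integer part of \<open>log 2 n\<close>;
      \<open>k + 1\<close> then serves both as the shortcut exponent and as the bound on
      halvings.\<close>
    obtain k where k: "2 ^ k \<le> n" "n < 2 ^ (k + 1)"
      using ex_power_ivl1[of 2 n] n by auto
    have "k \<ge> 1"
      using k(2) n by (cases k) auto
    have "real k \<le> log 2 (real n)"
      using k(1) n by (simp add: le_log_of_power)
    have init: "descending n init_parents" "flat init_parents"
      by (auto simp: descending_def flat_def init_parents_def)
    have "card (active_roots n E init_parents) \<le> card {1..n}"
      by (rule card_mono) (auto simp: active_roots_def)
    then have card: "card (active_roots n E init_parents) < 2 ^ (k + 1)"
      using k(2) by simp
    have "real (steps cost ops) \<le> real (25 * K) * (log 2 (real n))\<^sup>2"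
      if "algorithm_S n E ops p" for ops p
    proof -
      have "length ops \<le> (2 * (k + 1) + 1) * (k + 1 + 3)"
        using repeat_round_length[OF graph _ init card] k(2) that less_imp_le
        unfolding algorithm_S_def by blast
      \<comment> \<open>For \<open>k \<ge> 1\<close> both \<open>2 * k + 3\<close> and
        \<open>k + 4\<close> are at most \<open>5 * k\<close>, whence the factor 25.\<close>
      also have "\<dots> \<le> (5 * k) * (5 * k)"
        using \<open>k \<ge> 1\<close> by (intro mult_le_mono) auto
      finally have "K * length ops \<le> K * (25 * k\<^sup>2)"
        by (simp add: power2_eq_square)
      then have "steps cost ops \<le> 25 * K * k\<^sup>2"
        using steps_le_length[of cost ops] unfolding K_def by (simp add: algebra_simps)
      then have "real (steps cost ops) \<le> real (25 * K) * (real k)\<^sup>2"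
        by (metis of_nat_le_iff of_nat_mult of_nat_power)
      also have "\<dots> \<le> real (25 * K) * (log 2 (real n))\<^sup>2"
        using \<open>real k \<le> log 2 (real n)\<close> by (intro mult_left_mono power_mono) auto
      finally show ?thesis .
    qed
    moreover have "\<exists>ops p. algorithm_S n E ops p"
      using repeat_round_exists[OF graph init card] unfolding algorithm_S_def .
    ultimately show ?thesis
      by blast
  qed
  then show ?thesis
    by blast
qed

end
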